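(* There exists a numerical constant $c_0>0$ such that the following holds for all integers $n,d\ge1$, $K_n\in[n]$, $K_d\in[d]$ and all $\lambda\in(0,1)$. Assume that $\lambda\le 1/2$, $K_n\le n/2$ and $$\max\left\{\lambda\sqrt{\min(K_n,K_d)},\ \lambda\frac{K_d}{\sqrt d}\right\}\le c_0 .$$ Then, for any estimator $f$ (any real-valued function of $Y$), $$\mathbb E[(f-x^\star)^2]\ \ge\ \frac{1}{32}\,\mathbb E[x^{\star2}].$$
   Context: Bayesian block model: $M=\lambda\mathbf 1\{S_n\times T_n\}$ (entry $\lambda$ on $S_n\times T_n$, zero elsewhere), where $S_n\subset[n]$ and $T_n\subset[d]$ are random and the variables $\mathbf 1\{i\in S_n\}$, $i\in[n]$, and $\mathbf 1\{j\in T_n\}$, $j\in[d]$, are all independent, Bernoulli with parameter $K_n/n$ and $K_d/d$ respectively. Conditionally on $M$, the entries of $Y\in\{-1,1\}^{n\times d}$ are independent with $\mathbb P[Y_{i,k}=1\mid M]=(1+M_{i,k})/2$. $\mathbb E$ is expectation under the joint law of $(M,Y)$. The target is $x^\star=\mathbf 1\{\exists k\in[d]:\ M_{1,k}>0\}$. *)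

theory Defs
  imports "HOL-Probability.Probability"
begin

text \<open>
  An \<open>n \<times> d\<close> matrix is a function on index pairs, of which only the entries in
  \<open>{1..n} \<times> {1..d}\<close> are meaningful; all entries outside are fixed to \<open>0\<close> in the laws below.
\<close>

type_synonym matrix_fun = "nat \<times> nat \<Rightarrow> real"

definition random_subset_pmf :: "nat \<Rightarrow> nat \<Rightarrow> nat set pmf" where
  "random_subset_pmf m K =
     map_pmf (\<lambda>b. {i \<in> {1..m}. b i})
       (Pi_pmf {1..m} False (\<lambda>_. bernoulli_pmf (real K / real m)))"

definition block_matrix :: "real \<Rightarrow> nat set \<Rightarrow> nat set \<Rightarrow> matrix_fun" where
  "block_matrix lam S T = (\<lambda>(i, k). lam * indicator (S \<times> T) (i, k))"

definition block_prior :: "nat \<Rightarrow> nat \<Rightarrow> nat \<Rightarrow> nat \<Rightarrow> real \<Rightarrow> matrix_fun pmf" where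
  "block_prior n d Kn Kd lam =
     map_pmf (\<lambda>(S, T). block_matrix lam S T)
       (pair_pmf (random_subset_pmf n Kn) (random_subset_pmf d Kd))"

definition observation_pmf :: "nat \<Rightarrow> nat \<Rightarrow> matrix_fun \<Rightarrow> matrix_fun pmf" where
  "observation_pmf n d M =
     Pi_pmf ({1..n} \<times> {1..d}) 0
       (\<lambda>ik. map_pmf (\<lambda>b. if b then 1 else -1) (bernoulli_pmf ((1 + M ik) / 2)))"

definition block_model :: "nat \<Rightarrow> nat \<Rightarrow> nat \<Rightarrow> nat \<Rightarrow> real \<Rightarrow> (matrix_fun \<times> matrix_fun) pmf" where
  "block_model n d Kn Kd lam =
     bind_pmf (block_prior n d Kn Kd lam)
       (\<lambda>M. map_pmf (\<lambda>Y. (M, Y)) (observation_pmf n d M))"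

definition x_star :: "nat \<Rightarrow> matrix_fun \<Rightarrow> real" where
  "x_star d M = of_bool (\<exists>k\<in>{1..d}. M (1, k) > 0)"

end

theory Submission
  imports Defs
begin

text \<open>
  Take the law of independent uniform signs as reference measure and write \<open>E\<close> for its expectation.
  Given the block \<open>S \<times> T\<close>, the observation has density
  \<open>L S T = (\<Prod>(i, k)\<in>S \<times> T. 1 + lam * Y (i, k))\<close>. Put \<open>p = Kn / n\<close>, \<open>q = Kd / d\<close>, and let \<open>S\<close> from now
  on be the set of rows other than row 1 that belong to the block. Its law does not depend on
  whether row 1 belongs to the block, and \<open>p \<le> 1 - p\<close>, so the risk of \<open>f\<close> is at least \<open>p\<close> times the
  average over \<open>S\<close> and \<open>T\<close> of
  \<open>E (L S T * f\<^sup>2) + E (L (insert 1 S) T * (f - t\<^sub>T)\<^sup>2)\<close>,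
  where \<open>t\<^sub>T\<close> is the indicator of \<open>T \<noteq> {}\<close>. The second moment of the target is \<open>p * m\<close> with
  \<open>m = 1 - (1 - q) ^ d \<ge> 1 / 2\<close>, so it suffices that this average is at least \<open>m / 32\<close>.

  Suppose that row 1 turns a density \<open>a\<close> into a density \<open>b\<close>. An \<open>f\<close> that is small in
  \<open>L\<^sup>2\<close> of \<open>a\<close> has, by Cauchy--Schwarz, a small mean under \<open>b\<close>, with constant the second moment
  \<open>X = E (b\<^sup>2 / a)\<close>; it is then far from a target of mean \<open>m\<close> under \<open>b\<close>. Hence the two errors add up to
  at least \<open>m\<^sup>2 / (2 * X)\<close> (lemma \<open>two_hypotheses_risk\<close>). What remains is to bound \<open>X\<close>, which
  depends on what is revealed to the estimator besides \<open>Y\<close>.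

  If \<open>Kd \<le> Kn\<close>, reveal \<open>S\<close> and \<open>T\<close>. Only row 1 is then informative, and \<open>X = (1 + lam\<^sup>2) ^ card T\<close>,
  whose mean is at most \<open>exp (lam\<^sup>2 * Kd)\<close> (lemma \<open>risk_given_columns\<close>).

  If \<open>Kn < Kd\<close>, reveal \<open>S\<close> alone, so that the densities are mixtures over \<open>T\<close>. Both mixtures are
  products over the columns, so \<open>X\<close> is a product of \<open>d\<close> factors. Row 1 perturbs a column by a
  quantity of mean zero and of order \<open>q * lam\<close>; a factor is therefore at most
  \<open>1 + lam\<^sup>2 * q\<^sup>2 * (1 + lam\<^sup>2) ^ card S\<close>, and \<open>X \<le> exp A\<close> with
  \<open>A = lam\<^sup>2 * Kd\<^sup>2 / d * (1 + lam\<^sup>2) ^ card S\<close> (lemma \<open>risk_given_rows\<close>). The mean of \<open>exp A\<close> over \<open>S\<close>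
  is out of control because \<open>A\<close> is itself exponential in \<open>card S\<close>, but only \<open>1 / X \<ge> 1 - A\<close> has to be
  averaged, and the mean of \<open>A\<close> is at most \<open>lam\<^sup>2 * Kd\<^sup>2 / d * exp (lam\<^sup>2 * Kn)\<close>.

  Both bounds are met with \<open>c0 = 1 / 2\<close>.
\<close>

section \<open>Uniform random signs\<close>

definition sign_pmf :: "'i set \<Rightarrow> ('i \<Rightarrow> real) pmf" where
  "sign_pmf I = Pi_pmf I 0 (\<lambda>_. pmf_of_set {-1, 1})"

lemma sign_pmf_values:
  assumes "finite I" "Y \<in> set_pmf (sign_pmf I)" "e \<in> I"
  shows "Y e = -1 \<or> Y e = 1"
  using assms by (auto simp: sign_pmf_def set_Pi_pmf PiE_dflt_def)

lemma finite_set_sign_pmf: "finite I \<Longrightarrow> finite (set_pmf (sign_pmf I))"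
  by (auto simp: sign_pmf_def set_Pi_pmf)

lemma integrable_sign_pmf [simp]:
  fixes g :: "('i \<Rightarrow> real) \<Rightarrow> real"
  shows "finite I \<Longrightarrow> integrable (measure_pmf (sign_pmf I)) g"
  by (intro integrable_measure_pmf_finite finite_set_sign_pmf)

lemma sign_expectation_mono:
  fixes g h :: "('i \<Rightarrow> real) \<Rightarrow> real"
  assumes "finite I" "\<And>Y. (\<And>e. e \<in> I \<Longrightarrow> Y e = -1 \<or> Y e = 1) \<Longrightarrow> g Y \<le> h Y"
  shows "measure_pmf.expectation (sign_pmf I) g \<le> measure_pmf.expectation (sign_pmf I) h"
  using assms by (intro integral_mono_AE AE_pmfI) (auto dest: sign_pmf_values)

lemma sign_expectation_cong:
  fixes g h :: "('i \<Rightarrow> real) \<Rightarrow> real"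
  assumes "finite I" "\<And>Y. (\<And>e. e \<in> I \<Longrightarrow> Y e = -1 \<or> Y e = 1) \<Longrightarrow> g Y = h Y"
  shows "measure_pmf.expectation (sign_pmf I) g = measure_pmf.expectation (sign_pmf I) h"
  using assms by (intro antisym sign_expectation_mono) auto

lemma sign_expectation_prod_entries:
  fixes g :: "'i \<Rightarrow> real \<Rightarrow> real"
  assumes I: "finite I" and A: "A \<subseteq> I"
    and nonneg: "\<And>e y. e \<in> A \<Longrightarrow> y \<in> {-1, 1} \<Longrightarrow> 0 \<le> g e y"
  shows "measure_pmf.expectation (sign_pmf I) (\<lambda>Y. \<Prod>e\<in>A. g e (Y e))
           = (\<Prod>e\<in>A. (g e 1 + g e (-1)) / 2)"
proof -
  have eq: "(\<Prod>e\<in>A. h e) = (\<Prod>e\<in>I. if e \<in> A then h e else 1)" for h :: "'i \<Rightarrow> real"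
    using I A by (simp add: prod.If_cases Int_absorb1)
  have "measure_pmf.expectation (sign_pmf I) (\<lambda>Y. \<Prod>e\<in>I. if e \<in> A then g e (Y e) else 1)
     = (\<Prod>e\<in>I. measure_pmf.expectation (pmf_of_set {-1, 1})
                   (\<lambda>y. if e \<in> A then g e y else 1))"
    unfolding sign_pmf_def
    by (rule expectation_prod_Pi_pmf)
       (use I nonneg in \<open>auto intro!: integrable_measure_pmf_finite\<close>)
  also have "\<dots> = (\<Prod>e\<in>I. if e \<in> A then (g e 1 + g e (-1)) / 2 else 1)"
    by (intro prod.cong refl) (simp add: integral_pmf_of_set)
  finally show ?thesis
    by (simp only: eq)
qed

lemma expectation_pair_pmf_mult:
  fixes g :: "'a \<Rightarrow> real" and h :: "'b \<Rightarrow> real"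
  assumes "finite (set_pmf P)" "finite (set_pmf Q)"
  shows "measure_pmf.expectation (pair_pmf P Q) (\<lambda>z. g (fst z) * h (snd z))
           = measure_pmf.expectation P g * measure_pmf.expectation Q h"
proof -
  have "measure_pmf.expectation (pair_pmf P Q) (\<lambda>z. g (fst z) * h (snd z))
     = (\<Sum>z\<in>set_pmf P \<times> set_pmf Q. g (fst z) * h (snd z) * pmf (pair_pmf P Q) z)"
    by (rule integral_measure_pmf_real) (use assms in auto)
  also have "\<dots> = (\<Sum>x\<in>set_pmf P. \<Sum>y\<in>set_pmf Q. (g x * pmf P x) * (h y * pmf Q y))"
    unfolding sum.cartesian_product
    by (intro sum.cong refl) (auto simp: pmf_pair)
  also have "\<dots> = measure_pmf.expectation P g * measure_pmf.expectation Q h"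
    using assms by (simp add: sum_product integral_measure_pmf_real[where A = "set_pmf _"])
  finally show ?thesis .
qed

text \<open>
  The law on \<open>I\<close> is the image of the product of the laws on \<open>A\<close> and \<open>I - A\<close> under gluing, and under
  gluing \<open>g\<close> sees only the first component and \<open>h\<close> only the second.
\<close>

lemma sign_expectation_mult_disjoint:
  fixes g h :: "('i \<Rightarrow> real) \<Rightarrow> real"
  assumes I: "finite I" and A: "A \<subseteq> I"
    and g: "\<And>Y Y'. (\<And>e. e \<in> A \<Longrightarrow> Y e = Y' e) \<Longrightarrow> g Y = g Y'"
    and h: "\<And>Y Y'. (\<And>e. e \<in> I - A \<Longrightarrow> Y e = Y' e) \<Longrightarrow> h Y = h Y'"
  shows "measure_pmf.expectation (sign_pmf I) (\<lambda>Y. g Y * h Y)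
           = measure_pmf.expectation (sign_pmf I) g * measure_pmf.expectation (sign_pmf I) h"
proof -
  define glue where "glue = (\<lambda>z e. if e \<in> A then fst z e else snd z e :: real)"
  have fin: "finite A" "finite (I - A)"
    using I A finite_subset by auto
  have I_eq: "sign_pmf I = map_pmf glue (pair_pmf (sign_pmf A) (sign_pmf (I - A)))"
  proof -
    have "sign_pmf (A \<union> (I - A)) = map_pmf glue (pair_pmf (sign_pmf A) (sign_pmf (I - A)))"
      unfolding sign_pmf_def glue_def case_prod_unfold[symmetric]
      using fin by (subst Pi_pmf_union) (auto simp: case_prod_unfold)
    then show ?thesis
      using A by (simp add: Un_absorb1)
  qed
  have gg: "g (glue z) = g (fst z)" for z
    by (rule g) (simp add: glue_def)
  have hg: "h (glue z) = h (snd z)" for z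
    by (rule h) (simp add: glue_def)
  have mult: "measure_pmf.expectation (sign_pmf I) (\<lambda>Y. g Y * h Y)
      = measure_pmf.expectation (sign_pmf A) g * measure_pmf.expectation (sign_pmf (I - A)) h"
    using fin by (simp add: I_eq gg hg expectation_pair_pmf_mult finite_set_sign_pmf)
  have "measure_pmf.expectation (sign_pmf I) g = measure_pmf.expectation (sign_pmf A) g"
       "measure_pmf.expectation (sign_pmf I) h = measure_pmf.expectation (sign_pmf (I - A)) h"
    by (simp_all add: I_eq gg hg)
  with mult show ?thesis by simp
qed

text \<open>
  This is what makes the columns of the observation independent once the rows of the block are known.
\<close>

lemma sign_expectation_prod_blocks:
  fixes g :: "'k \<Rightarrow> ('i \<Rightarrow> real) \<Rightarrow> real"
  assumes I: "finite I" and K: "finite K"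
    and B: "\<And>k. k \<in> K \<Longrightarrow> B k \<subseteq> I" "disjoint_family_on B K"
    and g: "\<And>k Y Y'. k \<in> K \<Longrightarrow> (\<And>e. e \<in> B k \<Longrightarrow> Y e = Y' e) \<Longrightarrow> g k Y = g k Y'"
  shows "measure_pmf.expectation (sign_pmf I) (\<lambda>Y. \<Prod>k\<in>K. g k Y)
           = (\<Prod>k\<in>K. measure_pmf.expectation (sign_pmf I) (g k))"
  using K B g
proof (induction K rule: finite_induct)
  case (insert k K)
  have disj: "B k \<inter> B j = {}" if "j \<in> K" for j
    using insert.prems(2) insert.hyps that by (auto simp: disjoint_family_on_def)
  have "measure_pmf.expectation (sign_pmf I) (\<lambda>Y. g k Y * (\<Prod>j\<in>K. g j Y))
     = measure_pmf.expectation (sign_pmf I) (g k)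
       * measure_pmf.expectation (sign_pmf I) (\<lambda>Y. \<Prod>j\<in>K. g j Y)"
  proof (rule sign_expectation_mult_disjoint[where A = "B k"])
    fix Y Y' :: "'i \<Rightarrow> real"
    assume eq: "\<And>e. e \<in> I - B k \<Longrightarrow> Y e = Y' e"
    have "g j Y = g j Y'" if "j \<in> K" for j
    proof (rule insert.prems(3))
      fix e assume "e \<in> B j"
      then have "e \<in> I - B k"
        using disj[OF that] insert.prems(1)[of j] that by auto
      then show "Y e = Y' e" by (rule eq)
    qed (use that in simp)
    then show "(\<Prod>j\<in>K. g j Y) = (\<Prod>j\<in>K. g j Y')" by simp
  next
    show "g k Y = g k Y'" if "\<And>e. e \<in> B k \<Longrightarrow> Y e = Y' e" for Y Y'
      by (rule insert.prems(3)) (use that in simp_all)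
  qed (use I insert.prems(1) in simp_all)
  also have "measure_pmf.expectation (sign_pmf I) (\<lambda>Y. \<Prod>j\<in>K. g j Y)
      = (\<Prod>j\<in>K. measure_pmf.expectation (sign_pmf I) (g j))"
  proof (rule insert.IH)
    show "disjoint_family_on B K"
      using insert.prems(2) by (simp add: disjoint_family_on_def)
    show "g j Y = g j Y'" if "j \<in> K" "\<And>e. e \<in> B j \<Longrightarrow> Y e = Y' e" for j Y Y'
      by (rule insert.prems(3)) (use that in simp_all)
  qed (use insert.prems(1) in simp)
  finally show ?case
    using insert.hyps by simp
qed simp

text \<open>
  The change of measure to uniform signs: a sign with mean \<open>M e\<close> has density \<open>1 + M e * y\<close>.
\<close>

lemma expectation_observation_pmf:
  fixes g :: "matrix_fun \<Rightarrow> real"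
  assumes M: "\<And>e. \<bar>M e\<bar> \<le> 1"
  shows "measure_pmf.expectation (observation_pmf n d M) g
    = measure_pmf.expectation (sign_pmf ({1..n} \<times> {1..d}))
        (\<lambda>Y. (\<Prod>e\<in>{1..n} \<times> {1..d}. 1 + M e * Y e) * g Y)"
proof -
  define I where "I = {1..n} \<times> {1..d}"
  have [simp]: "finite I" by (simp add: I_def)
  let ?q = "\<lambda>e. map_pmf (\<lambda>b. if b then 1 else - 1 :: real) (bernoulli_pmf ((1 + M e) / 2))"
  have one: "pmf (?q e) y = (1 + M e * y) * pmf (pmf_of_set {-1, 1}) y" for e y
  proof -
    have p: "0 \<le> (1 + M e) / 2" "(1 + M e) / 2 \<le> 1"
      using M[of e] by (auto simp: abs_le_iff)
    have inj: "inj (\<lambda>b. if b then 1 else - 1 :: real)"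
      by (auto simp: inj_def)
    consider "y = 1" | "y = -1" | "y \<noteq> 1" "y \<noteq> -1" by blast
    then show ?thesis
    proof cases
      case 1
      then show ?thesis using p pmf_map_inj'[OF inj, of "bernoulli_pmf ((1 + M e) / 2)" True]
        by (simp add: pmf_of_set)
    next
      case 2
      then show ?thesis using p pmf_map_inj'[OF inj, of "bernoulli_pmf ((1 + M e) / 2)" False]
        by (simp add: pmf_of_set field_simps)
    next
      case 3
      then have "pmf (?q e) y = 0" by (intro pmf_map_outside) auto
      with 3 show ?thesis by (simp add: pmf_of_set)
    qed
  qed
  have all: "pmf (observation_pmf n d M) Y = (\<Prod>e\<in>I. 1 + M e * Y e) * pmf (sign_pmf I) Y" for Y
    unfolding observation_pmf_def sign_pmf_def I_def[symmetric]
    unfolding pmf_Pi[OF \<open>finite I\<close>] one prod.distrib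
    by (simp only: if_distrib[where f = "(*) _"] mult_zero_right)
  have sub: "set_pmf (observation_pmf n d M) \<subseteq> set_pmf (sign_pmf I)"
    by (auto simp: set_pmf_iff all)
  show ?thesis
    unfolding I_def[symmetric]
    using sub
    by (subst (1 2) integral_measure_pmf_real[where A = "set_pmf (sign_pmf I)"])
       (auto simp: finite_set_sign_pmf all mult_ac)
qed

section \<open>Bernoulli subsets\<close>

text \<open>
  The probability that the random subset of \<open>A\<close> in which every element is kept independently with
  probability \<open>p\<close> equals \<open>S\<close>. Two constant products, rather than powers of \<open>p\<close> and \<open>1 - p\<close>, are the shape
  in which a product of sums over \<open>A\<close> expands.
\<close>

definition subset_weight :: "real \<Rightarrow> 'a set \<Rightarrow> 'a set \<Rightarrow> real" where
  "subset_weight p A S = (\<Prod>i\<in>S. p) * (\<Prod>i\<in>A - S. 1 - p)"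

lemma subset_weight_nonneg: "0 \<le> p \<Longrightarrow> p \<le> 1 \<Longrightarrow> 0 \<le> subset_weight p A S"
  by (simp add: subset_weight_def)

text \<open>
  The generating function of the random subset. It yields the moments of its cardinality and
  turns a mixture of block likelihoods over the columns of the block into a product over columns.
\<close>

lemma sum_subset_weight_prod:
  assumes "finite A"
  shows "(\<Sum>S\<in>Pow A. subset_weight p A S * (\<Prod>i\<in>S. x i)) = (\<Prod>i\<in>A. 1 - p + p * x i)"
proof -
  have "(\<Prod>i\<in>A. p * x i + (1 - p)) = (\<Sum>S\<in>Pow A. (\<Prod>i\<in>S. p * x i) * (\<Prod>i\<in>A - S. 1 - p))"
    by (rule prod_add) (rule assms)
  then show ?thesis
    by (simp add: subset_weight_def prod.distrib mult_ac add.commute)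
qed

lemma sum_subset_weight: "finite A \<Longrightarrow> (\<Sum>S\<in>Pow A. subset_weight p A S) = 1"
  using sum_subset_weight_prod[of A p "\<lambda>_. 1"] by simp

lemma sum_subset_weight_power:
  assumes "finite A"
  shows "(\<Sum>S\<in>Pow A. subset_weight p A S * x ^ card S) = (1 - p + p * x) ^ card A"
  using sum_subset_weight_prod[OF assms, of p "\<lambda>_. x"] by simp

lemma sum_subset_weight_nonempty:
  assumes "finite A"
  shows "(\<Sum>S\<in>Pow A. subset_weight p A S * of_bool (S \<noteq> {})) = 1 - (1 - p) ^ card A"
proof -
  have "(\<Sum>S\<in>Pow A. subset_weight p A S * of_bool (S \<noteq> {}))
      = (\<Sum>S\<in>Pow A. subset_weight p A S) - (\<Sum>S\<in>Pow A. if S = {} then subset_weight p A S else 0)"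
    by (subst sum_subtractf[symmetric]) (auto intro!: sum.cong)
  also have "\<dots> = 1 - (1 - p) ^ card A"
    using assms by (simp add: sum_subset_weight sum.delta) (simp add: subset_weight_def)
  finally show ?thesis .
qed

text \<open>
  Conditioning on whether the element \<open>a\<close> is kept; used to single out row 1.
\<close>

lemma sum_subset_weight_insert:
  assumes "finite A" "a \<notin> A"
  shows "(\<Sum>S\<in>Pow (insert a A). subset_weight p (insert a A) S * g S)
    = (\<Sum>S\<in>Pow A. subset_weight p A S * ((1 - p) * g S + p * g (insert a S)))"
proof -
  have "inj_on (insert a) (Pow A)"
    using assms by (intro inj_onI) (metis PowD insert_ident subsetD)
  moreover have "subset_weight p (insert a A) S = (1 - p) * subset_weight p A S"
    and "subset_weight p (insert a A) (insert a S) = p * subset_weight p A S" if "S \<subseteq> A" for S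
  proof -
    have "finite S" "a \<notin> S" "insert a A - S = insert a (A - S)" "insert a A - insert a S = A - S"
      using assms that finite_subset by auto
    then show "subset_weight p (insert a A) S = (1 - p) * subset_weight p A S"
      and "subset_weight p (insert a A) (insert a S) = p * subset_weight p A S"
      using assms by (auto simp: subset_weight_def)
  qed
  moreover have "Pow A \<inter> insert a ` Pow A = {}"
    using assms by auto
  ultimately show ?thesis
    using assms
    by (simp add: Pow_insert sum.union_disjoint sum.reindex distrib_left sum.distrib mult_ac)
qed

lemma expectation_random_subset_pmf:
  fixes g :: "nat set \<Rightarrow> real"
  assumes "K \<le> m"
  shows "measure_pmf.expectation (random_subset_pmf m K) g
    = (\<Sum>S\<in>Pow {1..m}. subset_weight (real K / real m) {1..m} S * g S)"
proof -
  define p where "p = real K / real m"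
  have p: "0 \<le> p" "p \<le> 1"
    using assms by (auto simp: p_def divide_le_eq)
  let ?P = "Pi_pmf {1..m} False (\<lambda>_. bernoulli_pmf p)"
  let ?h = "\<lambda>S i. i \<in> S :: bool"
  have "measure_pmf.expectation (random_subset_pmf m K) g
      = measure_pmf.expectation ?P (\<lambda>b. g {i \<in> {1..m}. b i})"
    by (simp add: random_subset_pmf_def p_def)
  also have "\<dots> = (\<Sum>b\<in>?h ` Pow {1..m}. g {i \<in> {1..m}. b i} * pmf ?P b)"
  proof (rule integral_measure_pmf_real)
    fix b assume "b \<in> set_pmf ?P"
    then have "\<And>i. i \<notin> {1..m} \<Longrightarrow> \<not> b i"
      by (simp add: set_Pi_pmf PiE_dflt_def)
    then have "b = (\<lambda>i. i \<in> {i \<in> {1..m}. b i})" by auto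
    then show "b \<in> ?h ` Pow {1..m}" by blast
  qed simp
  also have "\<dots> = (\<Sum>S\<in>Pow {1..m}. g {i \<in> {1..m}. i \<in> S} * pmf ?P (\<lambda>i. i \<in> S))"
    by (subst sum.reindex) (auto simp: inj_on_def fun_eq_iff)
  also have "\<dots> = (\<Sum>S\<in>Pow {1..m}. subset_weight p {1..m} S * g S)"
  proof (rule sum.cong)
    fix S assume "S \<in> Pow {1..m}"
    then have S: "S \<subseteq> {1..m}" by simp
    have "pmf ?P (\<lambda>i. i \<in> S) = (\<Prod>i\<in>{1..m}. if i \<in> S then p else 1 - p)"
      using S p by (auto simp: pmf_Pi intro!: prod.cong)
    also have "\<dots> = subset_weight p {1..m} S"
      using S by (simp add: subset_weight_def prod.If_cases Int_absorb1 Diff_eq)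
    finally have "pmf ?P (\<lambda>i. i \<in> S) = subset_weight p {1..m} S" .
    moreover have "{i \<in> {1..m}. i \<in> S} = S" using S by auto
    ultimately show "g {i \<in> {1..m}. i \<in> S} * pmf ?P (\<lambda>i. i \<in> S) = subset_weight p {1..m} S * g S"
      by simp
  qed simp
  finally show ?thesis by (simp add: p_def)
qed

section \<open>The second-moment bound\<close>

text \<open>
  A second-moment form of Le Cam's two-point bound: \<open>a\<close> is the density of a null hypothesis with
  target \<open>0\<close>, and the \<open>b j\<close> are the components of a mixture with targets \<open>t j\<close> and mean target \<open>m\<close>. Instead of
  Cauchy--Schwarz, the proof expands two squares with a free multiplier \<open>c\<close>, one for each
  hypothesis, so that the terms that are linear in \<open>f\<close> cancel. This leaves
  \<open>2 * c * m - c\<^sup>2 * (1 + X)\<close>, and after \<open>1 + X \<le> 2 * X\<close> the best multiplier is \<open>c = m / (2 * X)\<close>.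
\<close>

lemma two_hypotheses_risk:
  fixes f :: "'y \<Rightarrow> real" and a :: "'y \<Rightarrow> real" and b :: "'j \<Rightarrow> 'y \<Rightarrow> real"
  assumes fin: "finite (set_pmf P)"
    and a: "\<And>y. y \<in> set_pmf P \<Longrightarrow> 0 < a y"
    and b: "\<And>j y. j \<in> J \<Longrightarrow> y \<in> set_pmf P \<Longrightarrow> 0 \<le> b j y"
    and mass: "measure_pmf.expectation P (\<lambda>y. \<Sum>j\<in>J. b j y) = 1"
    and target: "measure_pmf.expectation P (\<lambda>y. \<Sum>j\<in>J. b j y * t j) = m"
    and moment: "measure_pmf.expectation P (\<lambda>y. (\<Sum>j\<in>J. b j y)\<^sup>2 / a y) \<le> X"
    and X: "1 \<le> X"
  shows "m\<^sup>2 / (2 * X)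
    \<le> measure_pmf.expectation P (\<lambda>y. a y * (f y)\<^sup>2 + (\<Sum>j\<in>J. b j y * (f y - t j)\<^sup>2))"
proof -
  have [simp]: "integrable (measure_pmf P) g" for g :: "'y \<Rightarrow> real"
    by (rule integrable_measure_pmf_finite) (rule fin)
  define c where "c = m / (2 * X)"
  define B where "B = (\<lambda>y. \<Sum>j\<in>J. b j y)"
  let ?lower = "\<lambda>y. 2 * c * (\<Sum>j\<in>J. b j y * t j) - c\<^sup>2 * B y - c\<^sup>2 * ((B y)\<^sup>2 / a y)"
  have pointwise: "?lower y \<le> a y * (f y)\<^sup>2 + (\<Sum>j\<in>J. b j y * (f y - t j)\<^sup>2)"
    if y: "y \<in> set_pmf P" for y
  proof -
    \<comment> \<open>The equality case, in which \<open>f\<close> is \<open>c\<close> times the likelihood ratio \<open>B / a\<close>.\<close>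
    have "0 \<le> (a y * f y - c * B y)\<^sup>2 / a y"
      using a[OF y] by simp
    also have "\<dots> = a y * (f y)\<^sup>2 - 2 * c * B y * f y + c\<^sup>2 * ((B y)\<^sup>2 / a y)"
      using a[OF y] by (simp add: power2_eq_square field_simps)
    finally have null: "2 * c * B y * f y - c\<^sup>2 * ((B y)\<^sup>2 / a y) \<le> a y * (f y)\<^sup>2"
      by linarith
    \<comment> \<open>The equality case, in which \<open>f\<close> falls short of every target by \<open>c\<close>.\<close>
    have "0 \<le> (\<Sum>j\<in>J. b j y * (f y - t j + c)\<^sup>2)"
      using b[OF _ y] by (intro sum_nonneg) simp
    also have "\<dots> = (\<Sum>j\<in>J. b j y * (f y - t j)\<^sup>2 + 2 * c * f y * b j y
                        - 2 * c * (b j y * t j) + c\<^sup>2 * b j y)"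
      by (intro sum.cong refl) (simp add: power2_eq_square algebra_simps)
    also have "\<dots> = (\<Sum>j\<in>J. b j y * (f y - t j)\<^sup>2) + 2 * c * f y * B y
                        - 2 * c * (\<Sum>j\<in>J. b j y * t j) + c\<^sup>2 * B y"
      by (simp add: B_def sum.distrib sum_subtractf sum_distrib_left)
    finally show ?thesis using null by (simp add: algebra_simps)
  qed
  have "m\<^sup>2 / (2 * X) = 2 * c * m - 2 * c\<^sup>2 * X"
    using X by (simp add: c_def power2_eq_square field_simps)
  also have "\<dots> \<le> 2 * c * m - c\<^sup>2 - c\<^sup>2 * X"
    using mult_left_mono[OF X, of "c\<^sup>2"] by (simp add: algebra_simps)
  also have "\<dots> \<le> 2 * c * m - c\<^sup>2 - c\<^sup>2 * measure_pmf.expectation P (\<lambda>y. (B y)\<^sup>2 / a y)"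
    using mult_left_mono[OF moment, of "c\<^sup>2"] by (simp add: B_def)
  also have "\<dots> = measure_pmf.expectation P ?lower"
    using mass target by (simp add: B_def del: times_divide_eq_right)
  also have "\<dots> \<le> measure_pmf.expectation P
                    (\<lambda>y. a y * (f y)\<^sup>2 + (\<Sum>j\<in>J. b j y * (f y - t j)\<^sup>2))"
    by (intro integral_mono_AE AE_pmfI pointwise) simp_all
  finally show ?thesis .
qed

section \<open>Block likelihoods\<close>

definition column_lik :: "real \<Rightarrow> 'a set \<Rightarrow> 'b \<Rightarrow> ('a \<times> 'b \<Rightarrow> real) \<Rightarrow> real" where
  "column_lik lam S k Y = (\<Prod>i\<in>S. 1 + lam * Y (i, k))"

definition block_lik :: "real \<Rightarrow> 'a set \<Rightarrow> 'b set \<Rightarrow> ('a \<times> 'b \<Rightarrow> real) \<Rightarrow> real" where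
  "block_lik lam S T Y = (\<Prod>k\<in>T. column_lik lam S k Y)"

lemma block_lik_eq_prod_entries:
  "block_lik lam S T Y = (\<Prod>e\<in>S \<times> T. 1 + lam * Y e)"
  unfolding block_lik_def column_lik_def
  by (subst prod.swap) (simp add: prod.cartesian_product case_prod_unfold)

lemma column_lik_insert:
  "finite S \<Longrightarrow> r \<notin> S \<Longrightarrow> column_lik lam (insert r S) k Y = column_lik lam S k Y * (1 + lam * Y (r, k))"
  by (simp add: column_lik_def)

lemma entry_factor_pos:
  fixes lam y :: real
  assumes "\<bar>lam\<bar> < 1" "y = -1 \<or> y = 1"
  shows "0 < 1 + lam * y"
  using assms by auto

lemma column_lik_pos:
  assumes "\<bar>lam\<bar> < 1" "\<And>i. i \<in> S \<Longrightarrow> Y (i, k) = -1 \<or> Y (i, k) = 1"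
  shows "0 < column_lik lam S k Y"
  unfolding column_lik_def using assms by (intro prod_pos entry_factor_pos) auto

lemma block_lik_pos:
  assumes "\<bar>lam\<bar> < 1" "\<And>i k. i \<in> S \<Longrightarrow> k \<in> T \<Longrightarrow> Y (i, k) = -1 \<or> Y (i, k) = 1"
  shows "0 < block_lik lam S T Y"
  unfolding block_lik_def using assms by (intro prod_pos column_lik_pos) auto

lemma sum_subset_weight_block_lik:
  assumes "finite D"
  shows "(\<Sum>T\<in>Pow D. subset_weight q D T * block_lik lam S T Y)
    = (\<Prod>k\<in>D. 1 - q + q * column_lik lam S k Y)"
  unfolding block_lik_def using assms by (rule sum_subset_weight_prod)

lemma expectation_block_lik:
  assumes "finite N" "finite D" "S \<subseteq> N" "T \<subseteq> D" "\<bar>lam\<bar> < 1"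
  shows "measure_pmf.expectation (sign_pmf (N \<times> D)) (block_lik lam S T) = 1"
proof -
  have "measure_pmf.expectation (sign_pmf (N \<times> D)) (\<lambda>Y. \<Prod>e\<in>S \<times> T. 1 + lam * Y e)
      = (\<Prod>e\<in>S \<times> T. (1 + lam * 1 + (1 + lam * (-1))) / 2)"
    using assms by (intro sign_expectation_prod_entries) auto
  then show ?thesis
    by (simp add: block_lik_eq_prod_entries[abs_def])
qed

lemma expectation_column_lik:
  assumes "finite N" "finite D" "S \<subseteq> N" "k \<in> D" "\<bar>lam\<bar> < 1"
  shows "measure_pmf.expectation (sign_pmf (N \<times> D)) (column_lik lam S k) = 1"
  using expectation_block_lik[of N D S "{k}" lam] assms by (simp add: block_lik_def[abs_def])

lemma expectation_column_lik_square:
  assumes "finite N" "finite D" "S \<subseteq> N" "k \<in> D" "\<bar>lam\<bar> < 1"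
  shows "measure_pmf.expectation (sign_pmf (N \<times> D)) (\<lambda>Y. (column_lik lam S k Y)\<^sup>2)
    = (1 + lam\<^sup>2) ^ card S"
proof -
  have "(column_lik lam S k Y)\<^sup>2 = (\<Prod>e\<in>S \<times> {k}. (1 + lam * Y e)\<^sup>2)" for Y
    using block_lik_eq_prod_entries[of lam S "{k}" Y] by (simp add: block_lik_def prod_power_distrib)
  moreover have "measure_pmf.expectation (sign_pmf (N \<times> D)) (\<lambda>Y. \<Prod>e\<in>S \<times> {k}. (1 + lam * Y e)\<^sup>2)
      = (\<Prod>e\<in>S \<times> {k}. ((1 + lam * 1)\<^sup>2 + (1 + lam * (-1))\<^sup>2) / 2)"
    using assms by (intro sign_expectation_prod_entries) auto
  moreover have "((1 + lam * 1)\<^sup>2 + (1 + lam * (-1))\<^sup>2) / 2 = 1 + lam\<^sup>2"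
    by (simp add: power2_eq_square algebra_simps)
  ultimately show ?thesis by (simp only: prod_constant card_cartesian_product) simp
qed

text \<open>
  With \<open>S\<close> and \<open>T\<close> known, the likelihood ratio of the two hypotheses only involves the entries in row \<open>r\<close>
  and columns \<open>T\<close>. Each of them contributes the factor \<open>E (1 + lam * y)\<^sup>2 = 1 + lam\<^sup>2\<close> to the second
  moment.
\<close>

lemma risk_given_columns:
  assumes fin: "finite N" "finite D" and S: "S \<subseteq> N" "r \<in> N" "r \<notin> S" and T: "T \<subseteq> D"
    and lam: "\<bar>lam\<bar> < 1"
  shows "t\<^sup>2 / (2 * (1 + lam\<^sup>2) ^ card T)
    \<le> measure_pmf.expectation (sign_pmf (N \<times> D))
        (\<lambda>Y. block_lik lam S T Y * (f Y)\<^sup>2 + block_lik lam (insert r S) T Y * (f Y - t)\<^sup>2)"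
proof -
  have finS: "finite S" "finite T" using fin S T finite_subset by auto
  have signs: "Y (i, k) = -1 \<or> Y (i, k) = 1"
    if "Y \<in> set_pmf (sign_pmf (N \<times> D))" "i \<in> N" "k \<in> D" for Y i k
    using sign_pmf_values[OF _ that(1), of "(i, k)"] fin that by auto
  have ratio: "(block_lik lam (insert r S) T Y)\<^sup>2 / block_lik lam S T Y
      = (\<Prod>e\<in>insert r S \<times> T. if fst e = r then (1 + lam * Y e)\<^sup>2 else 1 + lam * Y e)"
    if pos: "0 < block_lik lam S T Y" for Y
  proof -
    define \<rho> where "\<rho> = (\<Prod>e\<in>{r} \<times> T. 1 + lam * Y e)"
    have split: "insert r S \<times> T = S \<times> T \<union> {r} \<times> T" "S \<times> T \<inter> {r} \<times> T = {}"
      using S by auto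
    have *: "block_lik lam (insert r S) T Y = block_lik lam S T Y * \<rho>"
      unfolding block_lik_eq_prod_entries \<rho>_def split(1)
      by (rule prod.union_disjoint) (use finS S in auto)
    have "(\<Prod>e\<in>insert r S \<times> T. if fst e = r then (1 + lam * Y e)\<^sup>2 else 1 + lam * Y e)
        = (\<Prod>e\<in>S \<times> T. if fst e = r then (1 + lam * Y e)\<^sup>2 else 1 + lam * Y e)
          * (\<Prod>e\<in>{r} \<times> T. if fst e = r then (1 + lam * Y e)\<^sup>2 else 1 + lam * Y e)"
      unfolding split(1) by (rule prod.union_disjoint) (use finS S in auto)
    also have "\<dots> = (\<Prod>e\<in>S \<times> T. 1 + lam * Y e) * (\<Prod>e\<in>{r} \<times> T. (1 + lam * Y e)\<^sup>2)"
      using S by (intro arg_cong2[where f = "(*)"] prod.cong refl) auto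
    also have "\<dots> = block_lik lam S T Y * \<rho>\<^sup>2"
      by (simp add: block_lik_eq_prod_entries \<rho>_def prod_power_distrib)
    finally show ?thesis
      using pos by (simp add: * power2_eq_square field_simps)
  qed
  have "measure_pmf.expectation (sign_pmf (N \<times> D))
          (\<lambda>Y. (block_lik lam (insert r S) T Y)\<^sup>2 / block_lik lam S T Y)
      = measure_pmf.expectation (sign_pmf (N \<times> D))
          (\<lambda>Y. \<Prod>e\<in>insert r S \<times> T. if fst e = r then (1 + lam * Y e)\<^sup>2 else 1 + lam * Y e)"
  proof (rule sign_expectation_cong)
    fix Y :: "'a \<times> 'b \<Rightarrow> real"
    assume "\<And>e. e \<in> N \<times> D \<Longrightarrow> Y e = -1 \<or> Y e = 1"
    then have "0 < block_lik lam S T Y"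
      using S T lam by (intro block_lik_pos) auto
    then show "(block_lik lam (insert r S) T Y)\<^sup>2 / block_lik lam S T Y
      = (\<Prod>e\<in>insert r S \<times> T. if fst e = r then (1 + lam * Y e)\<^sup>2 else 1 + lam * Y e)"
      by (rule ratio)
  qed (use fin in simp)
  also have "\<dots> = (\<Prod>e\<in>insert r S \<times> T.
      ((if fst e = r then (1 + lam * 1)\<^sup>2 else 1 + lam * 1)
       + (if fst e = r then (1 + lam * (-1))\<^sup>2 else 1 + lam * (-1))) / 2)"
    using fin S T lam by (intro sign_expectation_prod_entries) auto
  also have "\<dots> = (\<Prod>e\<in>insert r S \<times> T. if fst e = r then 1 + lam\<^sup>2 else 1)"
    by (intro prod.cong refl) (simp add: power2_eq_square algebra_simps)
  also have "\<dots> = (\<Prod>i\<in>insert r S. \<Prod>k\<in>T. if i = r then 1 + lam\<^sup>2 else 1)"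
    unfolding prod.cartesian_product by (intro prod.cong refl) auto
  also have "\<dots> = (1 + lam\<^sup>2) ^ card T"
  proof -
    have "(\<Prod>i\<in>S. \<Prod>k\<in>T. if i = r then 1 + lam\<^sup>2 else 1) = 1"
      using S by (intro prod.neutral ballI) auto
    then show ?thesis using finS S by simp
  qed
  finally have moment: "measure_pmf.expectation (sign_pmf (N \<times> D))
      (\<lambda>Y. (block_lik lam (insert r S) T Y)\<^sup>2 / block_lik lam S T Y) = (1 + lam\<^sup>2) ^ card T" .
  have mass: "measure_pmf.expectation (sign_pmf (N \<times> D)) (block_lik lam (insert r S) T) = 1"
    using fin S T lam by (intro expectation_block_lik) auto
  show ?thesis
    using two_hypotheses_risk[where P = "sign_pmf (N \<times> D)" and J = "{()}" and t = "\<lambda>_. t"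
        and a = "block_lik lam S T" and b = "\<lambda>_. block_lik lam (insert r S) T"
        and m = t and X = "(1 + lam\<^sup>2) ^ card T" and f = f]
      fin S T lam moment mass
    by (auto intro!: block_lik_pos less_imp_le[OF block_lik_pos] finite_set_sign_pmf
        dest!: signs)
qed

text \<open>
  Let \<open>L\<close> be the likelihood of the column without row \<open>r\<close>, \<open>z\<close> its entry in row \<open>r\<close>, and
  \<open>u = 1 - q + q * L\<close>. Adding row \<open>r\<close> turns \<open>u\<close> into \<open>u + q * lam * L * z\<close>. As \<open>z\<close> has mean zero and \<open>z\<^sup>2 = 1\<close>,
  the second moment is \<open>1 + lam\<^sup>2 * q\<^sup>2 * E (L\<^sup>2 / u)\<close>. Jensen's inequality
  \<open>1 / u \<le> 1 - q + q / L\<close> bounds \<open>L\<^sup>2 / u\<close> by \<open>(1 - q) * L\<^sup>2 + q * L\<close>. This is uniform in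
  \<open>q\<close>, whereas \<open>u \<ge> 1 - q\<close> would fail for \<open>q\<close> close to 1.
\<close>

lemma column_second_moment:
  fixes lam q :: real
  assumes fin: "finite N" "finite D" and S: "S \<subseteq> N" "r \<in> N" "r \<notin> S" and k: "k \<in> D"
    and lam: "\<bar>lam\<bar> < 1" and q: "0 \<le> q" "q \<le> 1"
  shows "measure_pmf.expectation (sign_pmf (N \<times> D))
      (\<lambda>Y. (1 - q + q * column_lik lam (insert r S) k Y)\<^sup>2 / (1 - q + q * column_lik lam S k Y))
    \<le> 1 + lam\<^sup>2 * q\<^sup>2 * (1 + lam\<^sup>2) ^ card S"
proof -
  have finS: "finite S" using fin S finite_subset by auto
  define L where "L = column_lik lam S k"
  define L' where "L' = column_lik lam (insert r S) k"
  let ?E = "measure_pmf.expectation (sign_pmf (N \<times> D))"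
  (* The term linear in z is expressed through L' and L, so that only expectations of
     products of nonnegative factors occur. *)
  have "?E (\<lambda>Y. (1 - q + q * L' Y)\<^sup>2 / (1 - q + q * L Y))
     \<le> ?E (\<lambda>Y. 1 - q + 2 * q * L' Y - q * L Y + lam\<^sup>2 * q\<^sup>2 * ((1 - q) * (L Y)\<^sup>2 + q * L Y))"
  proof (rule sign_expectation_mono)
    fix Y :: "'a \<times> 'b \<Rightarrow> real"
    assume Y: "\<And>e. e \<in> N \<times> D \<Longrightarrow> Y e = -1 \<or> Y e = 1"
    have L: "0 < L Y"
      unfolding L_def using S k lam Y by (intro column_lik_pos) auto
    define z where "z = Y (r, k)"
    have z: "z\<^sup>2 = 1"
      using Y[of "(r, k)"] S k by (auto simp: z_def)
    have L': "L' Y = L Y * (1 + lam * z)"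
      using S finS by (simp add: L'_def L_def column_lik_insert z_def)
    define u where "u = 1 - q + q * L Y"
    have u: "0 < u"
    proof (cases "q = 0")
      case False
      then have "0 < q * L Y" using q L by simp
      then show ?thesis using q by (simp add: u_def)
    qed (simp add: u_def)
    (* Jensen's inequality for 1 / u, cleared of denominators *)
    have "L Y \<le> L Y + q * (1 - q) * (L Y - 1)\<^sup>2"
      using q by simp
    also have "\<dots> = ((1 - q) * L Y + q) * u"
      by (simp add: u_def power2_eq_square algebra_simps)
    finally have "L Y / u \<le> (1 - q) * L Y + q"
      using u by (simp add: divide_le_eq)
    then have "L Y * (L Y / u) \<le> L Y * ((1 - q) * L Y + q)"
      using L by (intro mult_left_mono) auto
    then have sq: "(L Y)\<^sup>2 / u \<le> (1 - q) * (L Y)\<^sup>2 + q * L Y"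
      by (simp add: power2_eq_square algebra_simps)
    have "(1 - q + q * L' Y)\<^sup>2 / u = (u + q * lam * L Y * z)\<^sup>2 / u"
      by (simp add: L' u_def algebra_simps)
    also have "\<dots> = u + 2 * (q * lam * L Y * z) + lam\<^sup>2 * q\<^sup>2 * ((L Y)\<^sup>2 / u) * z\<^sup>2"
      using u by (simp add: power2_eq_square field_simps)
    also have "\<dots> \<le> u + 2 * (q * lam * L Y * z)
                  + lam\<^sup>2 * q\<^sup>2 * ((1 - q) * (L Y)\<^sup>2 + q * L Y)"
      using mult_left_mono[OF sq, of "lam\<^sup>2 * q\<^sup>2"] z by simp
    also have "u + 2 * (q * lam * L Y * z) = 1 - q + 2 * q * L' Y - q * L Y"
      by (simp add: u_def L' algebra_simps)
    finally show "(1 - q + q * L' Y)\<^sup>2 / (1 - q + q * L Y)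
       \<le> 1 - q + 2 * q * L' Y - q * L Y + lam\<^sup>2 * q\<^sup>2 * ((1 - q) * (L Y)\<^sup>2 + q * L Y)"
      by (simp add: u_def)
  qed (use fin in simp)
  also have "\<dots> = 1 - q + 2 * q * ?E L' - q * ?E L
      + lam\<^sup>2 * q\<^sup>2 * ((1 - q) * ?E (\<lambda>Y. (L Y)\<^sup>2) + q * ?E L)"
    using fin by simp
  also have "\<dots> = 1 + lam\<^sup>2 * q\<^sup>2 * ((1 - q) * (1 + lam\<^sup>2) ^ card S + q)"
  proof -
    have "?E L = 1" "?E L' = 1" "?E (\<lambda>Y. (L Y)\<^sup>2) = (1 + lam\<^sup>2) ^ card S"
      unfolding L_def L'_def
      using fin S k lam
      by (auto intro!: expectation_column_lik expectation_column_lik_square)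
    then show ?thesis by simp
  qed
  also have "\<dots> \<le> 1 + lam\<^sup>2 * q\<^sup>2 * (1 + lam\<^sup>2) ^ card S"
  proof -
    have "q * 1 \<le> q * (1 + lam\<^sup>2) ^ card S"
      using q by (intro mult_left_mono one_le_power) auto
    then have "(1 - q) * (1 + lam\<^sup>2) ^ card S + q \<le> (1 + lam\<^sup>2) ^ card S"
      by (simp add: algebra_simps)
    then show ?thesis
      by (intro add_left_mono mult_left_mono) auto
  qed
  finally show ?thesis by (simp add: L_def L'_def)
qed

text \<open>
  With only \<open>S\<close> known, the null density and the mixture are, by \<open>sum_subset_weight_block_lik\<close>, products over the
  columns, and so is the second moment of their ratio.
\<close>

lemma risk_given_rows:
  fixes lam q :: real
  assumes fin: "finite N" "finite D" and S: "S \<subseteq> N" "r \<in> N" "r \<notin> S"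
    and lam: "\<bar>lam\<bar> < 1" and q: "0 \<le> q" "q \<le> 1"
    and m: "(\<Sum>T\<in>Pow D. subset_weight q D T * t T) = m"
  shows "m\<^sup>2 / 2 * (1 - card D * (lam\<^sup>2 * q\<^sup>2 * (1 + lam\<^sup>2) ^ card S))
    \<le> (\<Sum>T\<in>Pow D. subset_weight q D T * measure_pmf.expectation (sign_pmf (N \<times> D))
        (\<lambda>Y. block_lik lam S T Y * (f Y)\<^sup>2 + block_lik lam (insert r S) T Y * (f Y - t T)\<^sup>2))"
proof -
  let ?E = "measure_pmf.expectation (sign_pmf (N \<times> D))"
  have finI: "finite (N \<times> D)" using fin by simp
  define x where "x = lam\<^sup>2 * q\<^sup>2 * (1 + lam\<^sup>2) ^ card S"
  have x: "0 \<le> x" by (simp add: x_def)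
  define X where "X = exp (card D * x)"
  define a where "a = (\<lambda>Y. \<Prod>k\<in>D. 1 - q + q * column_lik lam S k Y)"
  define b where "b = (\<lambda>T Y. subset_weight q D T * block_lik lam (insert r S) T Y)"
  have a_eq: "a Y = (\<Sum>T\<in>Pow D. subset_weight q D T * block_lik lam S T Y)" for Y
    using fin by (simp add: a_def sum_subset_weight_block_lik)
  have b_eq: "(\<Sum>T\<in>Pow D. b T Y) = (\<Prod>k\<in>D. 1 - q + q * column_lik lam (insert r S) k Y)" for Y
    using fin by (simp add: b_def sum_subset_weight_block_lik)
  have signs: "Y (i, k) = -1 \<or> Y (i, k) = 1"
    if "Y \<in> set_pmf (sign_pmf (N \<times> D))" "i \<in> N" "k \<in> D" for Y i k
    using sign_pmf_values[OF finI that(1), of "(i, k)"] that by auto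
  have a_pos: "0 < a Y" if Y: "Y \<in> set_pmf (sign_pmf (N \<times> D))" for Y
    unfolding a_def
  proof (rule prod_pos)
    fix k assume "k \<in> D"
    then have "0 < column_lik lam S k Y"
      using S lam signs[OF Y] by (intro column_lik_pos) auto
    then show "0 < 1 - q + q * column_lik lam S k Y"
      using q by (cases "q = 0") (auto intro!: add_nonneg_pos)
  qed
  have b_nonneg: "0 \<le> b T Y" if "T \<in> Pow D" "Y \<in> set_pmf (sign_pmf (N \<times> D))" for T Y
    unfolding b_def using that S lam signs[OF that(2)] q
    by (intro mult_nonneg_nonneg subset_weight_nonneg less_imp_le[OF block_lik_pos]) auto
  have lik_one: "?E (block_lik lam (insert r S) T) = 1" if "T \<in> Pow D" for T
    using that fin S lam by (intro expectation_block_lik) auto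
  have mass: "?E (\<lambda>Y. \<Sum>T\<in>Pow D. b T Y) = 1"
    using fin by (simp add: b_def lik_one sum_subset_weight)
  have target: "?E (\<lambda>Y. \<Sum>T\<in>Pow D. b T Y * t T) = m"
    using fin m by (simp add: b_def lik_one)
  have "?E (\<lambda>Y. (\<Sum>T\<in>Pow D. b T Y)\<^sup>2 / a Y)
      = ?E (\<lambda>Y. \<Prod>k\<in>D. (1 - q + q * column_lik lam (insert r S) k Y)\<^sup>2
                         / (1 - q + q * column_lik lam S k Y))"
    by (simp add: b_eq a_def prod_power_distrib prod_dividef)
  also have "\<dots> = (\<Prod>k\<in>D. ?E (\<lambda>Y. (1 - q + q * column_lik lam (insert r S) k Y)\<^sup>2
                         / (1 - q + q * column_lik lam S k Y)))"
  proof (rule sign_expectation_prod_blocks[where B = "\<lambda>k. insert r S \<times> {k}"])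
    fix k and Y Y' :: "'a \<times> 'b \<Rightarrow> real"
    assume "\<And>e. e \<in> insert r S \<times> {k} \<Longrightarrow> Y e = Y' e"
    then have "column_lik lam (insert r S) k Y = column_lik lam (insert r S) k Y'"
      and "column_lik lam S k Y = column_lik lam S k Y'"
      by (auto simp: column_lik_def intro!: prod.cong)
    then show "(1 - q + q * column_lik lam (insert r S) k Y)\<^sup>2 / (1 - q + q * column_lik lam S k Y)
       = (1 - q + q * column_lik lam (insert r S) k Y')\<^sup>2 / (1 - q + q * column_lik lam S k Y')"
      by simp
  qed (use fin S in \<open>auto simp: disjoint_family_on_def\<close>)
  also have "\<dots> \<le> (\<Prod>k\<in>D. 1 + x)"
  proof (rule prod_mono, rule conjI)
    fix k assume k: "k \<in> D"
    show "?E (\<lambda>Y. (1 - q + q * column_lik lam (insert r S) k Y)\<^sup>2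
                         / (1 - q + q * column_lik lam S k Y)) \<le> 1 + x"
      unfolding x_def using fin S k lam q by (intro column_second_moment)
    show "0 \<le> ?E (\<lambda>Y. (1 - q + q * column_lik lam (insert r S) k Y)\<^sup>2
                         / (1 - q + q * column_lik lam S k Y))"
    proof (intro integral_nonneg_AE AE_pmfI)
      fix Y assume Y: "Y \<in> set_pmf (sign_pmf (N \<times> D))"
      have "0 \<le> column_lik lam S k Y"
        using S lam k signs[OF Y] by (intro less_imp_le column_lik_pos) auto
      then show "0 \<le> (1 - q + q * column_lik lam (insert r S) k Y)\<^sup>2
                         / (1 - q + q * column_lik lam S k Y)"
        using q by simp
    qed
  qed
  also have "\<dots> \<le> X"
  proof -
    have "(1 + x) ^ card D \<le> exp x ^ card D"
      using x by (intro power_mono exp_ge_add_one_self) auto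
    then show ?thesis by (simp add: X_def exp_of_nat_mult)
  qed
  finally have moment: "?E (\<lambda>Y. (\<Sum>T\<in>Pow D. b T Y)\<^sup>2 / a Y) \<le> X" .
  have "m\<^sup>2 / (2 * X) \<le> ?E (\<lambda>Y. a Y * (f Y)\<^sup>2 + (\<Sum>T\<in>Pow D. b T Y * (f Y - t T)\<^sup>2))"
    by (rule two_hypotheses_risk)
       (use a_pos b_nonneg mass target moment finI x in \<open>auto intro: finite_set_sign_pmf simp: X_def\<close>)
  also have "\<dots> = ?E (\<lambda>Y. \<Sum>T\<in>Pow D. subset_weight q D T *
        (block_lik lam S T Y * (f Y)\<^sup>2 + block_lik lam (insert r S) T Y * (f Y - t T)\<^sup>2))"
    by (simp add: a_eq b_def sum_distrib_right sum.distrib distrib_left mult.assoc)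
  also have "\<dots> = (\<Sum>T\<in>Pow D. subset_weight q D T * ?E (\<lambda>Y.
        block_lik lam S T Y * (f Y)\<^sup>2 + block_lik lam (insert r S) T Y * (f Y - t T)\<^sup>2))"
    by (subst Bochner_Integration.integral_sum)
       (use finI in \<open>auto simp del: Bochner_Integration.integral_add\<close>)
  finally have risk: "m\<^sup>2 / (2 * X) \<le> \<dots>" .
  have "1 - card D * x \<le> exp (- (card D * x))"
    using exp_ge_add_one_self[of "- (card D * x)"] by simp
  then have "m\<^sup>2 / 2 * (1 - card D * x) \<le> m\<^sup>2 / 2 * exp (- (card D * x))"
    by (intro mult_left_mono) auto
  also have "\<dots> = m\<^sup>2 / (2 * X)"
    by (simp add: X_def exp_minus field_simps)
  finally show ?thesis
    using risk by (simp add: x_def)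
qed

section \<open>The risk in the block model\<close>

lemma expectation_bind_pmf_finite:
  fixes h :: "'b \<Rightarrow> real"
  assumes "finite (set_pmf P)" "\<And>x. finite (set_pmf (Q x))"
  shows "measure_pmf.expectation (bind_pmf P Q) h
    = measure_pmf.expectation P (\<lambda>x. measure_pmf.expectation (Q x) h)"
  using assms
  by (subst pmf_expectation_bind[where A = "set_pmf P"])
     (auto simp: integral_measure_pmf_real[where A = "set_pmf P"] mult.commute)

lemma finite_set_random_subset_pmf: "finite (set_pmf (random_subset_pmf m K))"
  by (rule finite_subset[where B = "Pow {1..m}"]) (auto simp: random_subset_pmf_def)

lemma finite_set_observation_pmf: "finite (set_pmf (observation_pmf n d M))"
  by (auto simp: observation_pmf_def set_Pi_pmf intro!: finite_PiE_dflt)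

lemma expectation_observation_block:
  fixes g :: "matrix_fun \<Rightarrow> real"
  assumes "S \<subseteq> {1..n}" "T \<subseteq> {1..d}" "\<bar>lam\<bar> \<le> 1"
  shows "measure_pmf.expectation (observation_pmf n d (block_matrix lam S T)) g
    = measure_pmf.expectation (sign_pmf ({1..n} \<times> {1..d})) (\<lambda>Y. block_lik lam S T Y * g Y)"
proof -
  have "(\<Prod>e\<in>{1..n} \<times> {1..d}. 1 + block_matrix lam S T e * Y e) = block_lik lam S T Y" for Y
    unfolding block_lik_eq_prod_entries
    by (rule prod.mono_neutral_cong_right)
       (use assms in \<open>auto simp: block_matrix_def\<close>)
  moreover have "\<bar>block_matrix lam S T e\<bar> \<le> 1" for e
    using assms by (cases e) (auto simp: block_matrix_def indicator_def)
  ultimately show ?thesis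
    by (subst expectation_observation_pmf) simp_all
qed

lemma expectation_block_model:
  fixes F :: "matrix_fun \<times> matrix_fun \<Rightarrow> real"
  assumes "Kn \<le> n" "Kd \<le> d" "\<bar>lam\<bar> \<le> 1"
  shows "measure_pmf.expectation (block_model n d Kn Kd lam) F
    = (\<Sum>S\<in>Pow {1..n}. subset_weight (real Kn / real n) {1..n} S
        * (\<Sum>T\<in>Pow {1..d}. subset_weight (real Kd / real d) {1..d} T
            * measure_pmf.expectation (sign_pmf ({1..n} \<times> {1..d}))
                (\<lambda>Y. block_lik lam S T Y * F (block_matrix lam S T, Y))))"
proof -
  have "block_model n d Kn Kd lam = bind_pmf (random_subset_pmf n Kn) (\<lambda>S.
      bind_pmf (random_subset_pmf d Kd) (\<lambda>T.
      map_pmf (Pair (block_matrix lam S T)) (observation_pmf n d (block_matrix lam S T))))"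
    by (simp add: block_model_def block_prior_def pair_pmf_def bind_map_pmf bind_assoc_pmf
        bind_return_pmf)
  then have "measure_pmf.expectation (block_model n d Kn Kd lam) F
      = measure_pmf.expectation (random_subset_pmf n Kn) (\<lambda>S.
          measure_pmf.expectation (random_subset_pmf d Kd) (\<lambda>T.
            measure_pmf.expectation (observation_pmf n d (block_matrix lam S T))
              (\<lambda>Y. F (block_matrix lam S T, Y))))"
    by (simp add: expectation_bind_pmf_finite finite_set_random_subset_pmf
        finite_set_observation_pmf)
  then show ?thesis
    using assms
    by (simp add: expectation_random_subset_pmf expectation_observation_block)
qed

lemma x_star_block_matrix:
  assumes "T \<subseteq> {1..d}" "0 < lam"
  shows "x_star d (block_matrix lam S T) = of_bool (1 \<in> S \<and> T \<noteq> {})"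
  using assms by (auto simp: x_star_def block_matrix_def indicator_def)

lemma one_plus_power_le_exp:
  fixes x :: real
  assumes "0 \<le> x"
  shows "(1 + x) ^ k \<le> exp (k * x)"
  using power_mono[OF exp_ge_add_one_self[of x], of k] assms by (simp add: exp_of_nat_mult)

lemma exp_quarter_le: "x \<le> 1 / 4 \<Longrightarrow> exp x \<le> (4 / 3 :: real)"
proof -
  assume "x \<le> 1 / 4"
  then have "3 / 4 \<le> exp (- x)"
    using exp_ge_add_one_self[of "- x"] by linarith
  then show "exp x \<le> 4 / 3"
    by (simp add: exp_minus field_simps)
qed

lemma nonempty_probability_ge_half:
  assumes "1 \<le> K" "K \<le> d"
  shows "1 / 2 \<le> 1 - (1 - real K / real d) ^ d"
proof -
  have "(1 - real K / real d) ^ d \<le> exp (- (real K / real d)) ^ d"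
    using assms exp_ge_add_one_self[of "- (real K / real d)"]
    by (intro power_mono) auto
  also have "\<dots> = exp (- real K)"
    using assms by (simp flip: exp_of_nat_mult)
  also have "\<dots> \<le> exp (- 1)"
    using assms by simp
  also have "\<dots> \<le> 1 / 2"
    using exp_ge_add_one_self[of "1 :: real"] by (simp add: exp_minus field_simps)
  finally show ?thesis by simp
qed

text \<open>
  The two regimes: the smaller of \<open>Kn\<close> and \<open>Kd\<close> decides whether the columns of the block are
  revealed. In both of them the reciprocal of the second moment \<open>X\<close> is bounded below by an expression whose
  average is explicit: \<open>1 / X \<ge> 2 - X\<close> when the columns are revealed, and the
  bound of \<open>risk_given_rows\<close> otherwise.
\<close>

lemma average_two_hypotheses_risk:
  fixes lam :: real and t :: "nat set \<Rightarrow> real" and f :: "matrix_fun \<Rightarrow> real"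
  assumes Kn: "Kn \<in> {1..n}" and Kd: "Kd \<in> {1..d}" and lam: "\<bar>lam\<bar> < 1"
    and small: "lam\<^sup>2 * real (min Kn Kd) \<le> 1 / 4" "lam\<^sup>2 * (real Kd)\<^sup>2 / real d \<le> 1 / 4"
    and p: "p = real Kn / real n" and q: "q = real Kd / real d"
    and t: "t = (\<lambda>T. of_bool (T \<noteq> {}))" and m: "m = 1 - (1 - q) ^ d"
  shows "1 / 32 * m \<le> (\<Sum>S\<in>Pow {2..n}. subset_weight p {2..n} S
      * (\<Sum>T\<in>Pow {1..d}. subset_weight q {1..d} T
          * measure_pmf.expectation (sign_pmf ({1..n} \<times> {1..d}))
              (\<lambda>Y. block_lik lam S T Y * (f Y)\<^sup>2 + block_lik lam (insert 1 S) T Y * (f Y - t T)\<^sup>2)))"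
    (is "_ \<le> (\<Sum>S\<in>_. _ * ?h S)")
proof -
  have p01: "0 \<le> p" "p \<le> 1" and q01: "0 \<le> q" "q \<le> 1"
    using Kn Kd by (auto simp: p q divide_le_eq)
  have m_half: "1 / 2 \<le> m"
    using nonempty_probability_ge_half[of Kd d] Kd by (simp add: m q)
  have m_le: "m \<le> 1"
    using q01 by (simp add: m)
  have m_sum: "(\<Sum>T\<in>Pow {1..d}. subset_weight q {1..d} T * t T) = m"
    using sum_subset_weight_nonempty[of "{1..d}" q] by (simp add: t m)
  have S: "S \<subseteq> {1..n}" "1 \<in> {1..n}" "1 \<notin> S" if "S \<in> Pow {2..n}" for S
    using that Kn by auto
  show ?thesis
  proof (cases "Kd \<le> Kn")
    case True
    have "m / 2 - 1 / 6 \<le> ?h S" if "S \<in> Pow {2..n}" for S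
    proof -
      have "(1 + q * lam\<^sup>2) ^ d \<le> exp (d * (q * lam\<^sup>2))"
        using q01 by (intro one_plus_power_le_exp) simp
      also have "\<dots> \<le> 4 / 3"
        using small(1) Kd by (intro exp_quarter_le) (simp add: q min_absorb2[OF True] mult.commute)
      finally have "m / 2 - 1 / 6 \<le> m / 2 - ((1 + q * lam\<^sup>2) ^ d - 1) / 2"
        by simp
      also have "\<dots> = (\<Sum>T\<in>Pow {1..d}. subset_weight q {1..d} T * t T) / 2
          - ((\<Sum>T\<in>Pow {1..d}. subset_weight q {1..d} T * (1 + lam\<^sup>2) ^ card T)
             - (\<Sum>T\<in>Pow {1..d}. subset_weight q {1..d} T)) / 2"
      proof -
        have base: "1 - q + q * (1 + lam\<^sup>2) = 1 + q * lam\<^sup>2"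
          by (simp add: algebra_simps)
        show ?thesis
          by (simp only: m_sum base sum_subset_weight_power sum_subset_weight finite_atLeastAtMost)
             simp
      qed
      also have "\<dots> = (\<Sum>T\<in>Pow {1..d}. subset_weight q {1..d} T
                           * (t T / 2 - ((1 + lam\<^sup>2) ^ card T - 1) / 2))"
        by (simp add: right_diff_distrib sum_subtractf diff_divide_distrib sum_divide_distrib)
      also have "\<dots> \<le> ?h S"
      proof (intro sum_mono mult_left_mono)
        fix T assume T: "T \<in> Pow {1..d}"
        define X where "X = (1 + lam\<^sup>2) ^ card T"
        have X: "1 \<le> X" by (simp add: X_def)
        have "t T / 2 - (X - 1) / 2 \<le> (t T)\<^sup>2 / (2 * X)"
        proof (cases "T = {}")
          case False
          have "0 \<le> (X - 1)\<^sup>2" by simp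
          then have "(2 - X) * X \<le> 1"
            by (simp add: power2_eq_square algebra_simps)
          then have "2 - X \<le> 1 / X" using X by (simp add: le_divide_eq)
          then show ?thesis using False by (simp add: t field_simps)
        qed (use X in \<open>simp add: t\<close>)
        also have "\<dots> \<le> measure_pmf.expectation (sign_pmf ({1..n} \<times> {1..d}))
              (\<lambda>Y. block_lik lam S T Y * (f Y)\<^sup>2
                   + block_lik lam (insert 1 S) T Y * (f Y - t T)\<^sup>2)"
          unfolding X_def using S[OF that] T lam by (intro risk_given_columns) auto
        finally show "t T / 2 - ((1 + lam\<^sup>2) ^ card T - 1) / 2 \<le> \<dots>"
          by (simp add: X_def)
      qed (use q01 in \<open>simp add: subset_weight_nonneg\<close>)
      finally show ?thesis .
    qed
    then have "(\<Sum>S\<in>Pow {2..n}. subset_weight p {2..n} S * (m / 2 - 1 / 6))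
        \<le> (\<Sum>S\<in>Pow {2..n}. subset_weight p {2..n} S * ?h S)"
      using p01 by (intro sum_mono mult_left_mono) (auto simp: subset_weight_nonneg)
    moreover have "(\<Sum>S\<in>Pow {2..n}. subset_weight p {2..n} S * (m / 2 - 1 / 6)) = m / 2 - 1 / 6"
      by (subst sum_distrib_right[symmetric]) (simp add: sum_subset_weight)
    ultimately show ?thesis using m_half by linarith
  next
    case False
    define z where "z = d * (lam\<^sup>2 * q\<^sup>2)"
    have "z = lam\<^sup>2 * (real Kd)\<^sup>2 / real d"
      using Kd by (simp add: z_def q power2_eq_square)
    then have z: "0 \<le> z" "z \<le> 1 / 4"
      using small(2) by simp_all
    have "(1 + p * lam\<^sup>2) ^ card {2..n} \<le> exp (card {2..n} * (p * lam\<^sup>2))"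
      using p01 by (intro one_plus_power_le_exp) simp
    also have "\<dots> \<le> exp (n * (p * lam\<^sup>2))"
      using p01 by (intro exp_le_cancel_iff[THEN iffD2] mult_right_mono) auto
    also have "\<dots> \<le> 4 / 3"
      using small(1) False Kn by (intro exp_quarter_le) (simp add: p min_absorb1 mult.commute)
    finally have "z * (1 + p * lam\<^sup>2) ^ card {2..n} \<le> 1 / 4 * (4 / 3)"
      using z p01 by (intro mult_mono) auto
    then have "m\<^sup>2 / 2 * (2 / 3) \<le> m\<^sup>2 / 2 * (1 - z * (1 + p * lam\<^sup>2) ^ card {2..n})"
      by (intro mult_left_mono) auto
    also have "\<dots> = m\<^sup>2 / 2 * ((\<Sum>S\<in>Pow {2..n}. subset_weight p {2..n} S)
        - z * (\<Sum>S\<in>Pow {2..n}. subset_weight p {2..n} S * (1 + lam\<^sup>2) ^ card S))"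
    proof -
      have base: "1 - p + p * (1 + lam\<^sup>2) = 1 + p * lam\<^sup>2"
        by (simp add: algebra_simps)
      show ?thesis
        by (simp only: base sum_subset_weight_power sum_subset_weight finite_atLeastAtMost)
    qed
    also have "\<dots> = (\<Sum>S\<in>Pow {2..n}. subset_weight p {2..n} S
                         * (m\<^sup>2 / 2 * (1 - z * (1 + lam\<^sup>2) ^ card S)))"
      unfolding sum_distrib_left sum_subtractf[symmetric]
      by (intro sum.cong refl) (simp add: algebra_simps)
    also have "\<dots> \<le> (\<Sum>S\<in>Pow {2..n}. subset_weight p {2..n} S * ?h S)"
    proof (intro sum_mono mult_left_mono)
      fix S assume "S \<in> Pow {2..n}"
      then show "m\<^sup>2 / 2 * (1 - z * (1 + lam\<^sup>2) ^ card S) \<le> ?h S"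
        using risk_given_rows[of "{1..n}" "{1..d}" S 1 lam q t m f] S[of S] lam q01 m_sum
        by (simp add: z_def mult.assoc)
    qed (use p01 in \<open>simp add: subset_weight_nonneg\<close>)
    finally have "m\<^sup>2 / 2 * (2 / 3) \<le> (\<Sum>S\<in>Pow {2..n}. subset_weight p {2..n} S * ?h S)" .
    moreover have "1 / 32 * m \<le> m\<^sup>2 / 2 * (2 / 3)"
      using mult_right_mono[OF m_half, of m] m_half by (simp add: power2_eq_square)
    ultimately show ?thesis by (rule order_trans[rotated])
  qed
qed

theorem proposition4p2:
  "\<exists>c0::real. c0 > 0 \<and>
     (\<forall>(n::nat) (d::nat) (Kn::nat) (Kd::nat) (lam::real).
        n \<ge> 1 \<longrightarrow> d \<ge> 1 \<longrightarrow> Kn \<in> {1..n} \<longrightarrow> Kd \<in> {1..d} \<longrightarrow> 0 < lam \<longrightarrow> lam < 1 \<longrightarrow>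
        lam \<le> 1 / 2 \<longrightarrow> real Kn \<le> real n / 2 \<longrightarrow>
        max (lam * sqrt (real (min Kn Kd))) (lam * (real Kd / sqrt (real d))) \<le> c0 \<longrightarrow>
        (\<forall>f :: matrix_fun \<Rightarrow> real.
           measure_pmf.expectation (block_model n d Kn Kd lam) (\<lambda>(M, Y). (f Y - x_star d M)\<^sup>2)
             \<ge> 1 / 32 * measure_pmf.expectation (block_model n d Kn Kd lam) (\<lambda>(M, Y). (x_star d M)\<^sup>2)))"
proof (intro exI[of _ "1 / 2"] conjI allI impI)
  fix n d Kn Kd :: nat and lam :: real and f :: "matrix_fun \<Rightarrow> real"
  assume n: "n \<ge> 1" and Kn: "Kn \<in> {1..n}" and Kd: "Kd \<in> {1..d}"
    and lam: "0 < lam" "lam < 1" and half: "real Kn \<le> real n / 2"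
    and max: "max (lam * sqrt (real (min Kn Kd))) (lam * (real Kd / sqrt (real d))) \<le> 1 / 2"
  define p where "p = real Kn / real n"
  define q where "q = real Kd / real d"
  define t :: "nat set \<Rightarrow> real" where "t = (\<lambda>T. of_bool (T \<noteq> {}))"
  define m where "m = 1 - (1 - q) ^ d"
  let ?E = "measure_pmf.expectation (sign_pmf ({1..n} \<times> {1..d}))"
  let ?w = "subset_weight q {1..d}"
  have p: "0 \<le> p" "p \<le> 1" "p \<le> 1 - p"
    using Kn half by (auto simp: p_def field_simps)
  have q: "0 \<le> q" "q \<le> 1"
    using Kd by (auto simp: q_def divide_le_eq)
  have "lam * sqrt (real (min Kn Kd)) \<le> 1 / 2" "lam * (real Kd / sqrt (real d)) \<le> 1 / 2"
    using max by (simp_all only: max.bounded_iff)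
  then have "(lam * sqrt (real (min Kn Kd)))\<^sup>2 \<le> (1 / 2)\<^sup>2"
       "(lam * (real Kd / sqrt (real d)))\<^sup>2 \<le> (1 / 2)\<^sup>2"
    using lam by (auto intro!: power_mono)
  then have small: "lam\<^sup>2 * real (min Kn Kd) \<le> 1 / 4" "lam\<^sup>2 * (real Kd)\<^sup>2 / real d \<le> 1 / 4"
    by (simp_all add: power_mult_distrib power_divide)
  have rows: "{1..n} = insert 1 {2..n}"
    using n by auto
  have split_rows: "measure_pmf.expectation (block_model n d Kn Kd lam) F
      = (\<Sum>S\<in>Pow {2..n}. subset_weight p {2..n} S *
          ((1 - p) * (\<Sum>T\<in>Pow {1..d}. ?w T * ?E (\<lambda>Y. block_lik lam S T Y * F (block_matrix lam S T, Y)))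
           + p * (\<Sum>T\<in>Pow {1..d}. ?w T * ?E (\<lambda>Y. block_lik lam (insert 1 S) T Y
                                         * F (block_matrix lam (insert 1 S) T, Y)))))"
    for F :: "matrix_fun \<times> matrix_fun \<Rightarrow> real"
  proof -
    have "measure_pmf.expectation (block_model n d Kn Kd lam) F
      = (\<Sum>S\<in>Pow {1..n}. subset_weight p {1..n} S *
          (\<Sum>T\<in>Pow {1..d}. ?w T * ?E (\<lambda>Y. block_lik lam S T Y * F (block_matrix lam S T, Y))))"
      unfolding p_def q_def using Kn Kd lam by (intro expectation_block_model) auto
    then show ?thesis
      unfolding rows by (subst (asm) sum_subset_weight_insert) auto
  qed
  have x: "x_star d (block_matrix lam S T) = 0"
          "x_star d (block_matrix lam (insert 1 S) T) = t T"
    if "S \<in> Pow {2..n}" "T \<in> Pow {1..d}" for S T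
    using that lam by (auto simp: x_star_block_matrix t_def)
  have "measure_pmf.expectation (block_model n d Kn Kd lam) (\<lambda>(M, Y). (x_star d M)\<^sup>2)
      = (\<Sum>S\<in>Pow {2..n}. subset_weight p {2..n} S * (p * m))"
    unfolding split_rows
  proof (intro sum.cong refl arg_cong2[where f = "(*)"])
    fix S assume S: "S \<in> Pow {2..n}"
    have "?E (\<lambda>Y. block_lik lam (insert 1 S) T Y) = 1" if "T \<in> Pow {1..d}" for T
      using S that n lam by (intro expectation_block_lik) auto
    then have "(\<Sum>T\<in>Pow {1..d}. ?w T * ?E (\<lambda>Y. block_lik lam (insert 1 S) T Y
          * (x_star d (block_matrix lam (insert 1 S) T))\<^sup>2))
        = (\<Sum>T\<in>Pow {1..d}. ?w T * t T)"
      using x(2)[OF S] by (intro sum.cong refl) (simp add: t_def del: One_nat_def)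
    also have "\<dots> = m"
      using sum_subset_weight_nonempty[of "{1..d}" q] by (simp add: t_def m_def)
    finally show "(1 - p) * (\<Sum>T\<in>Pow {1..d}. ?w T * ?E (\<lambda>Y. block_lik lam S T Y
            * (case (block_matrix lam S T, Y) of (M, Y) \<Rightarrow> (x_star d M)\<^sup>2)))
        + p * (\<Sum>T\<in>Pow {1..d}. ?w T * ?E (\<lambda>Y. block_lik lam (insert 1 S) T Y
            * (case (block_matrix lam (insert 1 S) T, Y) of (M, Y) \<Rightarrow> (x_star d M)\<^sup>2)))
        = p * m"
      using x(1)[OF S] by simp
  qed
  also have "\<dots> = p * m"
    by (subst sum_distrib_right[symmetric]) (simp add: sum_subset_weight)
  finally have second_moment:
    "measure_pmf.expectation (block_model n d Kn Kd lam) (\<lambda>(M, Y). (x_star d M)\<^sup>2) = p * m" .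
  have "1 / 32 * (p * m) = p * (1 / 32 * m)"
    by simp
  also have "\<dots> \<le> p * (\<Sum>S\<in>Pow {2..n}. subset_weight p {2..n} S * (\<Sum>T\<in>Pow {1..d}. ?w T
          * ?E (\<lambda>Y. block_lik lam S T Y * (f Y)\<^sup>2 + block_lik lam (insert 1 S) T Y * (f Y - t T)\<^sup>2)))"
    using Kn Kd lam small p
    by (intro mult_left_mono average_two_hypotheses_risk)
       (auto simp: p_def q_def t_def m_def)
  also have "\<dots> = (\<Sum>S\<in>Pow {2..n}. subset_weight p {2..n} S *
      (p * (\<Sum>T\<in>Pow {1..d}. ?w T * ?E (\<lambda>Y. block_lik lam S T Y * (f Y)\<^sup>2))
       + p * (\<Sum>T\<in>Pow {1..d}. ?w T * ?E (\<lambda>Y. block_lik lam (insert 1 S) T Y * (f Y - t T)\<^sup>2))))"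
    by (simp add: sum_distrib_left sum.distrib distrib_left mult_ac)
  (* Kn <= n / 2 enters here: the weight 1 - p of the null hypothesis is lowered to p. *)
  also have "\<dots> \<le> measure_pmf.expectation (block_model n d Kn Kd lam)
                      (\<lambda>(M, Y). (f Y - x_star d M)\<^sup>2)"
    unfolding split_rows
  proof (rule sum_mono, rule mult_left_mono, rule add_mono)
    fix S assume S: "S \<in> Pow {2..n}"
    have lik: "0 \<le> ?E (\<lambda>Y. block_lik lam S T Y * (f Y)\<^sup>2)" if T: "T \<in> Pow {1..d}" for T
    proof -
      have "?E (\<lambda>Y. 0) \<le> ?E (\<lambda>Y. block_lik lam S T Y * (f Y)\<^sup>2)"
      proof (rule sign_expectation_mono)
        fix Y :: matrix_fun
        assume Y: "\<And>e. e \<in> {1..n} \<times> {1..d} \<Longrightarrow> Y e = -1 \<or> Y e = 1"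
        have "0 < block_lik lam S T Y"
        proof (rule block_lik_pos)
          show "Y (i, k) = -1 \<or> Y (i, k) = 1" if "i \<in> S" "k \<in> T" for i k
            by (rule Y) (use S T that in auto)
        qed (use lam in simp)
        then show "0 \<le> block_lik lam S T Y * (f Y)\<^sup>2" by simp
      qed simp
      then show ?thesis by simp
    qed
    have "p * (\<Sum>T\<in>Pow {1..d}. ?w T * ?E (\<lambda>Y. block_lik lam S T Y * (f Y)\<^sup>2))
        \<le> (1 - p) * (\<Sum>T\<in>Pow {1..d}. ?w T * ?E (\<lambda>Y. block_lik lam S T Y * (f Y)\<^sup>2))"
      using p q lik
      by (intro mult_right_mono sum_nonneg mult_nonneg_nonneg subset_weight_nonneg) auto
    then show "p * (\<Sum>T\<in>Pow {1..d}. ?w T * ?E (\<lambda>Y. block_lik lam S T Y * (f Y)\<^sup>2))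
        \<le> (1 - p) * (\<Sum>T\<in>Pow {1..d}. ?w T * ?E (\<lambda>Y. block_lik lam S T Y
            * (case (block_matrix lam S T, Y) of (M, Y) \<Rightarrow> (f Y - x_star d M)\<^sup>2)))"
      using x(1)[OF S] by simp
    show "p * (\<Sum>T\<in>Pow {1..d}. ?w T * ?E (\<lambda>Y. block_lik lam (insert 1 S) T Y * (f Y - t T)\<^sup>2))
        \<le> p * (\<Sum>T\<in>Pow {1..d}. ?w T * ?E (\<lambda>Y. block_lik lam (insert 1 S) T Y
            * (case (block_matrix lam (insert 1 S) T, Y) of (M, Y) \<Rightarrow> (f Y - x_star d M)\<^sup>2)))"
      using x(2)[OF S] by simp
  qed (use p in \<open>simp add: subset_weight_nonneg\<close>)
  finally show "1 / 32 * measure_pmf.expectation (block_model n d Kn Kd lam) (\<lambda>(M, Y). (x_star d M)\<^sup>2)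
      \<le> measure_pmf.expectation (block_model n d Kn Kd lam) (\<lambda>(M, Y). (f Y - x_star d M)\<^sup>2)"
    by (simp add: second_moment)
qed simp

end
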